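(* Let $k$ be a fixed positive integer and $R$ a ring. There is an $O(n^2)$-time deterministic reduction from $k$-$\mathrm{MMV}_R$ on $n\times n$ matrices to $k$-$\mathrm{AllZeroes}_R$ on $2n\times 2n$ matrices.
   Context: $k$-$\mathrm{MMV}_R$: given $A_1,\ldots,A_k,C\in R^{n\times n}$, decide whether $\prod_{i=1}^k A_i = C$. $k$-$\mathrm{AllZeroes}_R$: given $A_1,\ldots,A_k\in R^{n\times n}$, decide whether $\prod_{i=1}^k A_i = 0$. A reduction maps each instance of the first problem to an instance of the second with the same yes/no answer; arithmetic operations over $R$ are counted as constant time. *)

theory Defs
  imports "Jordan_Normal_Form.Matrix" "HOL-Library.Landau_Symbols"
begin

text \<open>
  A ring is a type of sort \<open>{ring, monoid_mult}\<close>: associative and unital, not necessarily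
  commutative. The class \<open>ring_1\<close> would additionally exclude the zero ring.
\<close>

section \<open>Problems on lists of square matrices\<close>

text \<open>Both components are indexed by the dimension of the matrices.\<close>

record 'a problem =
  instances :: "nat \<Rightarrow> 'a mat list set"
  yes_instances :: "nat \<Rightarrow> 'a mat list set"

definition mat_prod_list :: "nat \<Rightarrow> 'a::{ring,monoid_mult} mat list \<Rightarrow> 'a mat" where
  "mat_prod_list n As = foldr (*) As (1\<^sub>m n)"

definition MMV :: "nat \<Rightarrow> 'a::{ring,monoid_mult} problem" where
  "MMV k = \<lparr>
     instances = (\<lambda>n. {As @ [C] | As C.
       length As = k \<and> set As \<subseteq> carrier_mat n n \<and> C \<in> carrier_mat n n}),
     yes_instances = (\<lambda>n. {As @ [C] | As C.
       length As = k \<and> set As \<subseteq> carrier_mat n n \<and> C \<in> carrier_mat n n \<and>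
       mat_prod_list n As = C}) \<rparr>"

definition AllZeroes :: "nat \<Rightarrow> 'a::{ring,monoid_mult} problem" where
  "AllZeroes k = \<lparr>
     instances = (\<lambda>n. {As. length As = k \<and> set As \<subseteq> carrier_mat n n}),
     yes_instances = (\<lambda>n. {As. length As = k \<and> set As \<subseteq> carrier_mat n n \<and>
       mat_prod_list n As = 0\<^sub>m n n}) \<rparr>"


section \<open>Random access machine over a ring\<close>

text \<open>
  A machine state has natural-number registers (for counters and addresses) and a memory of
  ring elements. Programs are uniform: the same program runs for every dimension, and, since
  0 and 1 are the only ring constants, its text does not mention the ring. Every elementary
  instruction and every evaluation of a branching condition costs one time unit. Registers
  have addition and truncated subtraction but no unit-cost multiplication, which on unbounded
  numbers would be unreasonably powerful.
\<close>

record 'a state =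
  reg :: "nat \<Rightarrow> nat"
  mem :: "nat \<Rightarrow> 'a"

text \<open>
  The arguments of the instructions are register numbers, except the second argument of
  \<open>IConst\<close>, which is a literal. All accesses to the ring memory are indirect.
\<close>

datatype instr =
    IConst nat nat
  | ICopy nat nat
  | IAdd nat nat nat
  | ISub nat nat nat
  | ILoad nat nat
  | IStore nat nat
  | RZero nat
  | ROne nat
  | RCopy nat nat
  | RAdd nat nat nat
  | RSub nat nat nat
  | RMult nat nat nat

fun exec :: "instr \<Rightarrow> 'a::{ring,monoid_mult} state \<Rightarrow> 'a state" where
  "exec (IConst x c) s = s\<lparr>reg := (reg s)(x := c)\<rparr>"
| "exec (ICopy x y) s = s\<lparr>reg := (reg s)(x := reg s y)\<rparr>"
| "exec (IAdd x y z) s = s\<lparr>reg := (reg s)(x := reg s y + reg s z)\<rparr>"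
| "exec (ISub x y z) s = s\<lparr>reg := (reg s)(x := reg s y - reg s z)\<rparr>"
| "exec (ILoad x y) s = s\<lparr>reg := (reg s)(x := reg s (reg s y))\<rparr>"
| "exec (IStore x y) s = s\<lparr>reg := (reg s)(reg s x := reg s y)\<rparr>"
| "exec (RZero x) s = s\<lparr>mem := (mem s)(reg s x := 0)\<rparr>"
| "exec (ROne x) s = s\<lparr>mem := (mem s)(reg s x := 1)\<rparr>"
| "exec (RCopy x y) s = s\<lparr>mem := (mem s)(reg s x := mem s (reg s y))\<rparr>"
| "exec (RAdd x y z) s = s\<lparr>mem := (mem s)(reg s x := mem s (reg s y) + mem s (reg s z))\<rparr>"
| "exec (RSub x y z) s = s\<lparr>mem := (mem s)(reg s x := mem s (reg s y) - mem s (reg s z))\<rparr>"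
| "exec (RMult x y z) s = s\<lparr>mem := (mem s)(reg s x := mem s (reg s y) * mem s (reg s z))\<rparr>"

datatype cond =
    CLess nat nat
  | CEq nat nat
  | CZero nat

fun holds :: "cond \<Rightarrow> 'a::{ring,monoid_mult} state \<Rightarrow> bool" where
  "holds (CLess x y) s = (reg s x < reg s y)"
| "holds (CEq x y) s = (reg s x = reg s y)"
| "holds (CZero x) s = (mem s (reg s x) = 0)"

datatype prog =
    Skip
  | Do instr
  | Seq prog prog
  | Cond cond prog prog
  | While cond prog

text \<open>\<open>run p s t s'\<close>: started in \<open>s\<close>, program \<open>p\<close> halts in \<open>s'\<close> after exactly \<open>t\<close> time units.\<close>

inductive run :: "prog \<Rightarrow> 'a::{ring,monoid_mult} state \<Rightarrow> nat \<Rightarrow> 'a state \<Rightarrow> bool" where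
  run_Skip: "run Skip s 0 s"
| run_Do: "run (Do i) s 1 (exec i s)"
| run_Seq: "run p s t s' \<Longrightarrow> run q s' u s'' \<Longrightarrow> run (Seq p q) s (t + u) s''"
| run_Cond_True: "holds b s \<Longrightarrow> run p s t s' \<Longrightarrow> run (Cond b p q) s (1 + t) s'"
| run_Cond_False: "\<not> holds b s \<Longrightarrow> run q s t s' \<Longrightarrow> run (Cond b p q) s (1 + t) s'"
| run_While_False: "\<not> holds b s \<Longrightarrow> run (While b p) s 1 s"
| run_While_True: "holds b s \<Longrightarrow> run p s t s' \<Longrightarrow> run (While b p) s' u s'' \<Longrightarrow>
    run (While b p) s (1 + t + u) s''"

inductive_cases run_SkipE: "run Skip s t s'"
inductive_cases run_DoE: "run (Do i) s t s'"
inductive_cases run_SeqE: "run (Seq p q) s t s'"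
inductive_cases run_CondE: "run (Cond b p q) s t s'"
inductive_cases run_WhileE: "run (While b p) s t s'"

lemma run_deterministic:
  "run p s t s' \<Longrightarrow> run p s u s'' \<Longrightarrow> t = u \<and> s' = s''"
proof (induction arbitrary: u s'' rule: run.induct)
  case (run_Skip s)
  then show ?case by (auto elim: run_SkipE)
next
  case (run_Do i s)
  then show ?case by (auto elim: run_DoE)
next
  case (run_Seq p s t s' q v r)
  from run_Seq.prems obtain t1 t2 s1
    where "run p s t1 s1" "run q s1 t2 s''" "u = t1 + t2" by (auto elim: run_SeqE)
  with run_Seq.IH show ?case by blast
next
  case (run_Cond_True b s p t s' q)
  from run_Cond_True.prems run_Cond_True.hyps obtain v
    where "run p s v s''" "u = 1 + v" by (auto elim: run_CondE)
  with run_Cond_True.IH show ?case by blast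
next
  case (run_Cond_False b s q t s' p)
  from run_Cond_False.prems run_Cond_False.hyps obtain v
    where "run q s v s''" "u = 1 + v" by (auto elim: run_CondE)
  with run_Cond_False.IH show ?case by blast
next
  case (run_While_False b s p)
  from run_While_False.prems run_While_False.hyps show ?case
    by (auto elim: run_WhileE)
next
  case (run_While_True b s p t s' v r)
  from run_While_True.prems run_While_True.hyps obtain t1 t2 s1
    where "run p s t1 s1" "run (While b p) s1 t2 s''" "u = 1 + t1 + t2"
    by (auto elim: run_WhileE)
  with run_While_True.IH show ?case by blast
qed

text \<open>
  A list of \<open>n \<times> n\<close> matrices is stored row by row, one matrix after the other. Register 0
  holds the dimension and register 1 the address of the first entry. The initial state stores
  the list from address 0 on; all other registers and cells are 0.
\<close>

definition represents :: "'a state \<Rightarrow> nat \<Rightarrow> 'a mat list \<Rightarrow> bool" where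
  "represents s n Ms \<longleftrightarrow> reg s 0 = n \<and>
     (\<forall>l < length Ms. \<forall>i < n. \<forall>j < n.
        mem s (reg s 1 + l * (n * n) + i * n + j) = (Ms ! l) $$ (i, j))"

definition initial_state :: "nat \<Rightarrow> 'a::zero mat list \<Rightarrow> 'a state" where
  "initial_state n Ms = \<lparr>
     reg = (\<lambda>_. 0)(0 := n),
     mem = (\<lambda>a. if a < length Ms * (n * n)
                then (Ms ! (a div (n * n))) $$ (a mod (n * n) div n, a mod n) else 0) \<rparr>"

lemma represents_initial_state: "represents (initial_state n Ms) n Ms"
proof -
  have "mem (initial_state n Ms) (l * (n * n) + i * n + j) = (Ms ! l) $$ (i, j)"
    if l: "l < length Ms" and i: "i < n" and j: "j < n" for l i j
  proof -
    have "i * n + j < Suc i * n" using j by simp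
    also have "\<dots> \<le> n * n" using i by (intro mult_le_mono1) simp
    finally have b: "i * n + j < n * n" .
    have "l * (n * n) + (i * n + j) < Suc l * (n * n)" using b by simp
    also have "\<dots> \<le> length Ms * (n * n)" using l by (intro mult_le_mono1) simp
    finally have c: "l * (n * n) + (i * n + j) < length Ms * (n * n)" .
    have d: "(l * (n * n) + (i * n + j)) div (n * n) = l"
      using b by (metis add.right_neutral div_less div_mult_self3 less_nat_zero_code)
    have e: "(l * (n * n) + (i * n + j)) mod (n * n) = i * n + j" using b by simp
    have f: "(i * n + j) div n = i" "(i * n + j) mod n = j" using j by simp_all
    have g: "(l * (n * n) + (i * n + j)) mod n = j"
      using e f(2) by (metis mod_mod_cancel dvd_triv_left)
    show ?thesis using c d e f g by (simp add: initial_state_def add.assoc)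
  qed
  then show ?thesis by (simp add: represents_def) (simp add: initial_state_def)
qed


section \<open>Reductions with a time bound\<close>

text \<open>
  Program \<open>p\<close> maps every instance of \<open>X\<close> of dimension \<open>n\<close> to an instance of \<open>Y\<close> of
  dimension \<open>d n\<close> with the same answer, within \<open>T n\<close> time units.
\<close>

definition is_reduction ::
  "prog \<Rightarrow> 'a::{ring,monoid_mult} problem \<Rightarrow> 'a problem \<Rightarrow> (nat \<Rightarrow> nat) \<Rightarrow> (nat \<Rightarrow> nat) \<Rightarrow> bool"
where
  "is_reduction p X Y d T \<longleftrightarrow>
     (\<forall>n. \<forall>x \<in> instances X n. \<exists>t s. \<exists>y \<in> instances Y (d n).
        run p (initial_state n x) t s \<and> t \<le> T n \<and> represents s (d n) y \<and>
        (x \<in> yes_instances X n \<longleftrightarrow> y \<in> yes_instances Y (d n)))"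

end

theory Submission
  imports Defs
begin

text \<open>
  Put \<open>U\<^sub>1 = [[A\<^sub>1, -C], [0, 0]]\<close> and \<open>U\<^sub>i = [[A\<^sub>i, 0], [0, I]]\<close> for \<open>i > 1\<close>. Then
  \<open>U\<^sub>1 \<cdots> U\<^sub>k = [[A\<^sub>1 \<cdots> A\<^sub>k, -C], [0, 0]]\<close>, and multiplication by \<open>F = [[I, 0], [I, 0]]\<close> adds the
  right block column to the left one. Hence the \<open>k\<close> matrices \<open>U\<^sub>1, \<dots>, U\<^sub>k F\<close> have the product
  \<open>[[A\<^sub>1 \<cdots> A\<^sub>k - C, 0], [0, 0]]\<close>. They are written behind the input, where the memory is still
  zero, quadrant by quadrant; a quadrant takes \<open>O(n\<^sup>2)\<close> steps and at most \<open>2 k\<close> of them are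
  nonzero.
\<close>

section \<open>Matrix products\<close>

text \<open>
  The unit laws of the library are stated for the class \<open>semiring_1\<close>, which excludes the zero ring.
\<close>

lemma left_mult_one_mat_monoid:
  fixes A :: "'a::{semiring_0,monoid_mult} mat"
  assumes "A \<in> carrier_mat nr nc"
  shows "1\<^sub>m nr * A = A"
proof (rule eq_matI)
  fix i j assume "i < dim_row A" "j < dim_col A"
  then have "(1\<^sub>m nr * A) $$ (i, j) = (\<Sum>l = 0..<nr. (if i = l then 1 else 0) * A $$ (l, j))"
    using assms by (auto simp: scalar_prod_def intro!: sum.cong)
  also have "\<dots> = (\<Sum>l = 0..<nr. if i = l then A $$ (l, j) else 0)"
    by (intro sum.cong) auto
  also have "\<dots> = A $$ (i, j)"
    using assms \<open>i < dim_row A\<close> by simp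
  finally show "(1\<^sub>m nr * A) $$ (i, j) = A $$ (i, j)" .
qed (use assms in auto)

lemma right_mult_one_mat_monoid:
  fixes A :: "'a::{semiring_0,monoid_mult} mat"
  assumes "A \<in> carrier_mat nr nc"
  shows "A * 1\<^sub>m nc = A"
proof (rule eq_matI)
  fix i j assume "i < dim_row A" "j < dim_col A"
  then have "(A * 1\<^sub>m nc) $$ (i, j) = (\<Sum>l = 0..<nc. A $$ (i, l) * (if l = j then 1 else 0))"
    using assms by (auto simp: scalar_prod_def intro!: sum.cong)
  also have "\<dots> = (\<Sum>l = 0..<nc. if l = j then A $$ (i, l) else 0)"
    by (intro sum.cong) auto
  also have "\<dots> = A $$ (i, j)"
    using assms \<open>j < dim_col A\<close> by simp
  finally show "(A * 1\<^sub>m nc) $$ (i, j) = A $$ (i, j)" .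
qed (use assms in auto)

lemma minus_mat_eq_zero_iff:
  fixes A B :: "'a::group_add mat"
  assumes "A \<in> carrier_mat nr nc" "B \<in> carrier_mat nr nc"
  shows "A - B = 0\<^sub>m nr nc \<longleftrightarrow> A = B"
proof
  assume diff: "A - B = 0\<^sub>m nr nc"
  show "A = B"
  proof (rule eq_matI)
    fix i j assume "i < dim_row B" "j < dim_col B"
    then have "A $$ (i, j) - B $$ (i, j) = 0"
      using diff assms index_minus_mat(1)[of i B j A] by simp
    then show "A $$ (i, j) = B $$ (i, j)" by simp
  qed (use assms in auto)
qed (use assms in simp)

lemma four_block_zero_mat_iff:
  assumes "A \<in> carrier_mat nr1 nc1"
  shows "four_block_mat A (0\<^sub>m nr1 nc2) (0\<^sub>m nr2 nc1) (0\<^sub>m nr2 nc2) = 0\<^sub>m (nr1 + nr2) (nc1 + nc2)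
    \<longleftrightarrow> A = 0\<^sub>m nr1 nc1"
    (is "?F = _ \<longleftrightarrow> _")
proof
  assume zero: "?F = 0\<^sub>m (nr1 + nr2) (nc1 + nc2)"
  show "A = 0\<^sub>m nr1 nc1"
  proof (rule eq_matI)
    fix i j assume ij: "i < dim_row (0\<^sub>m nr1 nc1)" "j < dim_col (0\<^sub>m nr1 nc1)"
    then have "?F $$ (i, j) = A $$ (i, j)" using assms by simp
    then show "A $$ (i, j) = 0\<^sub>m nr1 nc1 $$ (i, j)" using ij zero by simp
  qed (use assms in auto)
qed simp

lemma mat_prod_list_Nil [simp]: "mat_prod_list n [] = 1\<^sub>m n"
  by (simp add: mat_prod_list_def)

lemma mat_prod_list_Cons [simp]: "mat_prod_list n (A # As) = A * mat_prod_list n As"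
  by (simp add: mat_prod_list_def)

lemma mat_prod_list_carrier [simp]:
  "set As \<subseteq> carrier_mat n n \<Longrightarrow> mat_prod_list n As \<in> carrier_mat n n"
  by (induction As) auto

lemma mat_prod_list_snoc:
  assumes "set As \<subseteq> carrier_mat n n" "B \<in> carrier_mat n n"
  shows "mat_prod_list n (As @ [B]) = mat_prod_list n As * B"
  using assms
proof (induction As)
  case Nil
  then show ?case by (simp add: left_mult_one_mat_monoid right_mult_one_mat_monoid)
next
  case (Cons A As)
  then have "A * (mat_prod_list n As * B) = A * mat_prod_list n As * B"
    by (intro assoc_mult_mat[symmetric]) auto
  then show ?case using Cons by simp
qed

section \<open>The block matrices\<close>

definition augment :: "nat \<Rightarrow> 'a::{ring,monoid_mult} mat \<Rightarrow> 'a mat \<Rightarrow> 'a mat" where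
  "augment n C A = four_block_mat A (- C) (0\<^sub>m n n) (0\<^sub>m n n)"

definition border :: "nat \<Rightarrow> 'a::{ring,monoid_mult} mat \<Rightarrow> 'a mat" where
  "border n A = four_block_mat A (0\<^sub>m n n) (0\<^sub>m n n) (1\<^sub>m n)"

definition stacked_identity :: "nat \<Rightarrow> 'a::{ring,monoid_mult} mat" where
  "stacked_identity n = four_block_mat (1\<^sub>m n) (0\<^sub>m n n) (1\<^sub>m n) (0\<^sub>m n n)"

lemma augment_carrier [simp]:
  "A \<in> carrier_mat n n \<Longrightarrow> augment n C A \<in> carrier_mat (n + n) (n + n)"
  by (simp add: augment_def)

lemma border_carrier [simp]:
  "A \<in> carrier_mat n n \<Longrightarrow> border n A \<in> carrier_mat (n + n) (n + n)"
  by (simp add: border_def)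

lemma stacked_identity_carrier [simp]: "stacked_identity n \<in> carrier_mat (n + n) (n + n)"
  by (simp add: stacked_identity_def)

lemma augment_mult_border:
  assumes "A \<in> carrier_mat n n" "B \<in> carrier_mat n n" "C \<in> carrier_mat n n"
  shows "augment n C A * border n B = augment n C (A * B)"
  using assms unfolding augment_def border_def
  by (subst mult_four_block_mat[of _ n n _ n _ n _ _ n _ n])
    (auto simp: right_mult_one_mat_monoid)

lemma border_mult_border:
  assumes "A \<in> carrier_mat n n" "B \<in> carrier_mat n n"
  shows "border n A * border n B = border n (A * B)"
  using assms unfolding border_def
  by (subst mult_four_block_mat[of _ n n _ n _ n _ _ n _ n])
    (auto simp: right_mult_one_mat_monoid[of _ n n])

lemma four_block_mult_stacked_identity:
  fixes P :: "'a::{ring,monoid_mult} mat"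
  assumes "P \<in> carrier_mat n n" "Q \<in> carrier_mat n n" "R \<in> carrier_mat n n" "S \<in> carrier_mat n n"
  shows "four_block_mat P Q R S * stacked_identity n =
    four_block_mat (P + Q) (0\<^sub>m n n) (R + S) (0\<^sub>m n n)"
  using assms unfolding stacked_identity_def
  by (subst mult_four_block_mat[of _ n n _ n _ n _ _ n _ n])
    (auto simp: right_mult_one_mat_monoid)

lemma augment_mult_stacked_identity:
  assumes "A \<in> carrier_mat n n" "C \<in> carrier_mat n n"
  shows "augment n C A * stacked_identity n =
    four_block_mat (A - C) (0\<^sub>m n n) (0\<^sub>m n n) (0\<^sub>m n n)"
  using assms by (simp add: augment_def four_block_mult_stacked_identity add_uminus_minus_mat)

lemma border_mult_stacked_identity:
  assumes "A \<in> carrier_mat n n"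
  shows "border n A * stacked_identity n = four_block_mat A (0\<^sub>m n n) (1\<^sub>m n) (0\<^sub>m n n)"
  using assms by (simp add: border_def four_block_mult_stacked_identity)

lemma mat_prod_list_border:
  assumes "set As \<subseteq> carrier_mat n n"
  shows "mat_prod_list (n + n) (map (border n) As) = border n (mat_prod_list n As)"
  using assms
proof (induction As)
  case Nil
  show ?case by (simp add: border_def)
next
  case (Cons A As)
  then show ?case by (simp add: border_mult_border)
qed

definition base_factor :: "nat \<Rightarrow> 'a::{ring,monoid_mult} mat list \<Rightarrow> 'a mat \<Rightarrow> nat \<Rightarrow> 'a mat" where
  "base_factor n As C l = (if l = 0 then augment n C (As ! l) else border n (As ! l))"

definition factor :: "nat \<Rightarrow> 'a::{ring,monoid_mult} mat list \<Rightarrow> 'a mat \<Rightarrow> nat \<Rightarrow> 'a mat" where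
  "factor n As C l =
     (if Suc l = length As then base_factor n As C l * stacked_identity n
      else base_factor n As C l)"

lemma base_factor_carrier:
  assumes "set As \<subseteq> carrier_mat n n" "l < length As"
  shows "base_factor n As C l \<in> carrier_mat (n + n) (n + n)"
proof -
  have "As ! l \<in> carrier_mat n n" using assms by auto
  then show ?thesis by (cases "l = 0") (simp_all add: base_factor_def)
qed

lemma factor_carrier:
  assumes "set As \<subseteq> carrier_mat n n" "l < length As"
  shows "factor n As C l \<in> carrier_mat (n + n) (n + n)"
  using base_factor_carrier[OF assms]
  by (auto simp: factor_def intro: mult_carrier_mat[OF _ stacked_identity_carrier])

lemma mat_prod_list_base_factors:
  assumes "As \<noteq> []" and As: "set As \<subseteq> carrier_mat n n" and C: "C \<in> carrier_mat n n"
  shows "mat_prod_list (n + n) (map (base_factor n As C) [0..<length As]) =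
    augment n C (mat_prod_list n As)"
proof -
  obtain A As' where Cons: "As = A # As'" using \<open>As \<noteq> []\<close> by (cases As) auto
  have "map (base_factor n As C) [0..<length As] = augment n C A # map (border n) As'"
    unfolding Cons list.size add_Suc_right add_0_right map_upt_Suc
    by (auto simp: base_factor_def intro: nth_equalityI)
  then show ?thesis
    using As C by (simp add: Cons mat_prod_list_border augment_mult_border)
qed

lemma mat_prod_list_factors:
  assumes "As \<noteq> []" and As: "set As \<subseteq> carrier_mat n n" and C: "C \<in> carrier_mat n n"
  shows "mat_prod_list (n + n) (map (factor n As C) [0..<length As]) =
    four_block_mat (mat_prod_list n As - C) (0\<^sub>m n n) (0\<^sub>m n n) (0\<^sub>m n n)"
proof -
  let ?F = "stacked_identity n" and ?U = "base_factor n As C"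
  obtain m where m: "length As = Suc m" using \<open>As \<noteq> []\<close> by (cases As) auto
  have carrier: "?U l \<in> carrier_mat (n + n) (n + n)" if "l \<le> m" for l
    using base_factor_carrier[OF As] that by (simp add: m)
  then have init_carrier: "set (map ?U [0..<m]) \<subseteq> carrier_mat (n + n) (n + n)" by auto
  have "map (factor n As C) [0..<length As] = map ?U [0..<m] @ [?U m * ?F]"
    by (simp add: m factor_def)
  also have "mat_prod_list (n + n) \<dots> = mat_prod_list (n + n) (map ?U [0..<m]) * (?U m * ?F)"
    using init_carrier mult_carrier_mat[OF carrier[OF order_refl] stacked_identity_carrier]
    by (rule mat_prod_list_snoc)
  also have "\<dots> = mat_prod_list (n + n) (map ?U [0..<m]) * ?U m * ?F"
    using mat_prod_list_carrier[OF init_carrier] carrier[OF order_refl] stacked_identity_carrier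
    by (rule assoc_mult_mat[symmetric])
  also have "mat_prod_list (n + n) (map ?U [0..<m]) * ?U m =
      mat_prod_list (n + n) (map ?U [0..<length As])"
    using mat_prod_list_snoc[OF init_carrier carrier[OF order_refl]] by (simp add: m)
  also have "\<dots> = augment n C (mat_prod_list n As)"
    using assms by (rule mat_prod_list_base_factors)
  finally show ?thesis
    using As C by (simp add: augment_mult_stacked_identity)
qed

lemma mat_prod_list_factors_eq_zero_iff:
  assumes "As \<noteq> []" "set As \<subseteq> carrier_mat n n" "C \<in> carrier_mat n n"
  shows "mat_prod_list (n + n) (map (factor n As C) [0..<length As]) = 0\<^sub>m (n + n) (n + n) \<longleftrightarrow>
    mat_prod_list n As = C"
  using assms mat_prod_list_factors[OF assms]
  by (simp add: four_block_zero_mat_iff minus_mat_eq_zero_iff minus_carrier_mat)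

section \<open>Timed Hoare triples\<close>

definition triple ::
  "('a::{ring,monoid_mult} state \<Rightarrow> bool) \<Rightarrow> prog \<Rightarrow> nat \<Rightarrow> ('a state \<Rightarrow> bool) \<Rightarrow> bool" where
  "triple P p c Q \<longleftrightarrow> (\<forall>s. P s \<longrightarrow> (\<exists>t s'. run p s t s' \<and> t \<le> c \<and> Q s'))"

lemma triple_conseq:
  assumes "triple P p c Q" "\<And>s. P' s \<Longrightarrow> P s" "c \<le> c'" "\<And>s. Q s \<Longrightarrow> Q' s"
  shows "triple P' p c' Q'"
  using assms unfolding triple_def by (meson order_trans)

lemma triple_Skip: "triple P Skip 0 P"
  unfolding triple_def using run_Skip by blast

lemma triple_Do:
  assumes "\<And>s. P s \<Longrightarrow> Q (exec i s)"
  shows "triple P (Do i) 1 Q"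
  unfolding triple_def using assms run_Do by blast

lemma triple_Seq:
  assumes "triple P p c Q" "triple Q q d R"
  shows "triple P (Seq p q) (c + d) R"
  unfolding triple_def
proof (intro allI impI)
  fix s assume "P s"
  then obtain t s' where p: "run p s t s'" "t \<le> c" "Q s'"
    using assms(1) unfolding triple_def by blast
  then obtain u s'' where q: "run q s' u s''" "u \<le> d" "R s''"
    using assms(2) unfolding triple_def by blast
  show "\<exists>t s''. run (Seq p q) s t s'' \<and> t \<le> c + d \<and> R s''"
    using run_Seq[OF p(1) q(1)] p(2) q(2,3) by (meson add_mono)
qed

fun seq :: "prog list \<Rightarrow> prog" where
  "seq [] = Skip"
| "seq (p # ps) = Seq p (seq ps)"

lemma triple_seq_Nil: "triple P (seq []) 0 P"
  by (simp add: triple_Skip)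

lemma triple_seq_Cons:
  assumes "triple P p c Q" "triple Q (seq ps) d R"
  shows "triple P (seq (p # ps)) (c + d) R"
  using triple_Seq[OF assms] by simp

lemma triple_seq_upt:
  assumes "\<And>i. i < m \<Longrightarrow> triple (I i) (p i) c (I (Suc i))"
  shows "triple (I 0) (seq (map p [0..<m])) (m * c) (I m)"
  using assms
proof (induction m arbitrary: I p)
  case 0
  show ?case using triple_seq_Nil by simp
next
  case (Suc m)
  have "triple (I (Suc 0)) (seq (map (\<lambda>i. p (Suc i)) [0..<m])) (m * c) (I (Suc m))"
    using Suc.prems by (intro Suc.IH[of "\<lambda>i. I (Suc i)"]) simp
  from triple_seq_Cons[OF Suc.prems[of 0] this] show ?case
    unfolding map_upt_Suc by simp
qed

abbreviation instrs :: "instr list \<Rightarrow> prog" where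
  "instrs is \<equiv> seq (map Do is)"

lemma run_instrs: "run (instrs is) s (length is) (fold exec is s)"
proof (induction "is" arbitrary: s)
  case Nil
  show ?case by (simp add: run_Skip)
next
  case (Cons i "is")
  show ?case using run_Seq[OF run_Do Cons.IH] by simp
qed

lemma triple_instrs:
  assumes "\<And>s. P s \<Longrightarrow> Q (fold exec is s)" "length is \<le> c"
  shows "triple P (instrs is) c Q"
  unfolding triple_def using assms run_instrs by blast

lemma exec_IAdd_funpow:
  "x \<noteq> y \<Longrightarrow> (exec (IAdd x x y) ^^ m) s =
    s\<lparr>reg := (reg s)(x := reg s x + m * reg s y)\<rparr>"
  by (induction m arbitrary: s) (simp_all add: add_ac)

lemma triple_While_less:
  assumes regs: "\<And>i s. I i s \<Longrightarrow> reg s x = i \<and> reg s y = n"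
    and body: "\<And>i. i < n \<Longrightarrow> triple (I i) p c (I (Suc i))"
  shows "triple (I 0) (While (CLess x y) p) (n * (c + 1) + 1) (I n)"
proof -
  let ?w = "While (CLess x y) p"
  have "triple (I i) ?w ((n - i) * (c + 1) + 1) (I n)" if "i \<le> n" for i
    using that
  proof (induction rule: inc_induct)
    case base
    have "run ?w s 1 s" if "I n s" for s :: "'a state"
      using regs[OF that] by (intro run_While_False) simp
    then show ?case unfolding triple_def by fastforce
  next
    case (step i)
    show ?case unfolding triple_def
    proof (intro allI impI)
      fix s assume s: "I i s"
      then obtain t s' where first: "run p s t s'" "t \<le> c" "I (Suc i) s'"
        using body[OF step.hyps(2)] unfolding triple_def by blast
      then obtain u s'' where rest: "run ?w s' u s''" "u \<le> (n - Suc i) * (c + 1) + 1" "I n s''"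
        using step.IH unfolding triple_def by blast
      have "run ?w s (1 + t + u) s''"
        using regs[OF s] step.hyps by (intro run_While_True[OF _ first(1) rest(1)]) simp
      moreover have "n - i = Suc (n - Suc i)" using step.hyps by simp
      then have "1 + t + u \<le> (n - i) * (c + 1) + 1" using first(2) rest(2) by simp
      ultimately show "\<exists>t s'. run ?w s t s' \<and> t \<le> (n - i) * (c + 1) + 1 \<and> I n s'"
        using rest(3) by blast
    qed
  qed
  from this[of 0] show ?thesis by simp
qed

section \<open>Registers and counting loops\<close>

text \<open>
  Register 0 and register 1 are prescribed by the output convention; \<open>base_reg\<close> points to the
  first free cell behind the input, where the output is built up.
\<close>

abbreviation (input) dim_reg :: nat where "dim_reg \<equiv> 0"
abbreviation (input) base_reg :: nat where "base_reg \<equiv> 1"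
abbreviation (input) square_reg :: nat where "square_reg \<equiv> 2"
abbreviation (input) one_reg :: nat where "one_reg \<equiv> 3"
abbreviation (input) src_reg :: nat where "src_reg \<equiv> 4"
abbreviation (input) dst_reg :: nat where "dst_reg \<equiv> 5"
abbreviation (input) row_reg :: nat where "row_reg \<equiv> 6"
abbreviation (input) col_reg :: nat where "col_reg \<equiv> 7"

definition for_dim :: "nat \<Rightarrow> prog \<Rightarrow> prog" where
  "for_dim x p = seq [Do (IConst x 0), While (CLess x dim_reg) (seq [p, Do (IAdd x x one_reg)])]"

lemma triple_for_dim:
  assumes regs: "\<And>i s. I i s \<Longrightarrow> reg s dim_reg = n \<and> reg s one_reg = 1"
    and counter: "\<And>i s v. I i s \<Longrightarrow> I i (s\<lparr>reg := (reg s)(x := v)\<rparr>)"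
    and body: "\<And>i. i < n \<Longrightarrow>
      triple (\<lambda>s. I i s \<and> reg s x = i) p c (\<lambda>s. I (Suc i) s \<and> reg s x = i)"
    and x: "x \<noteq> dim_reg" "x \<noteq> one_reg"
  shows "triple (I 0) (for_dim x p) (n * (c + 2) + 2) (I n)"
proof -
  define J where "J i s \<longleftrightarrow> I i s \<and> reg s x = i" for i s
  have step: "triple (J i) (seq [p, Do (IAdd x x one_reg)]) (c + (1 + 0)) (J (Suc i))"
    if "i < n" for i
    using body[OF that] unfolding J_def
    by (rule triple_seq_Cons[OF _ triple_seq_Cons[OF triple_Do triple_seq_Nil]])
      (use regs counter in auto)
  have counters: "reg s x = i \<and> reg s dim_reg = n" if "J i s" for i s
    using that regs by (auto simp: J_def)
  have loop: "triple (J 0) (While (CLess x dim_reg) (seq [p, Do (IAdd x x one_reg)]))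
      (n * ((c + (1 + 0)) + 1) + 1) (J n)"
    using counters step by (rule triple_While_less)
  have init: "triple (I 0) (Do (IConst x 0)) 1 (J 0)"
    by (rule triple_Do) (use counter in \<open>auto simp: J_def\<close>)
  show ?thesis unfolding for_dim_def
    by (rule triple_conseq[OF triple_seq_Cons[OF init triple_seq_Cons[OF loop triple_seq_Nil]]])
      (auto simp: J_def)
qed

section \<open>Memory layout\<close>

definition input_cell :: "nat \<Rightarrow> nat \<Rightarrow> nat \<Rightarrow> nat \<Rightarrow> nat" where
  "input_cell n b i j = b * (n * n) + i * n + j"

text \<open>
  Behind \<open>m\<close> input matrices follow the output matrices of dimension \<open>2n\<close>; this is the address of
  entry \<open>(i, j)\<close> of the quadrant \<open>(r, c)\<close> of the \<open>l\<close>-th of them.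
\<close>

definition output_cell :: "nat \<Rightarrow> nat \<Rightarrow> nat \<Rightarrow> nat \<Rightarrow> nat \<Rightarrow> nat \<Rightarrow> nat \<Rightarrow> nat" where
  "output_cell n m l r c i j = m * (n * n) + ((((l * 2 + r) * n + i) * 2 + c) * n + j)"

lemma mult_add_less_inject:
  fixes n :: nat
  assumes "j < n" "j' < n"
  shows "i * n + j = i' * n + j' \<longleftrightarrow> i = i' \<and> j = j'"
proof
  assume eq: "i * n + j = i' * n + j'"
  have "(i * n + j) div n = i" "(i' * n + j') div n = i'" using assms by simp_all
  with eq show "i = i' \<and> j = j'" by simp
qed simp

lemma mult_add_less_square:
  fixes n :: nat
  assumes "i < n" "j < n"
  shows "i * n + j < n * n"
proof -
  have "i * n + j < Suc i * n" using assms by simp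
  also have "\<dots> \<le> n * n" using assms by (intro mult_le_mono1) simp
  finally show ?thesis .
qed

lemma output_cell_inject:
  assumes "r < 2" "c < 2" "i < n" "j < n" "r' < 2" "c' < 2" "i' < n" "j' < n"
  shows "output_cell n m l r c i j = output_cell n m l' r' c' i' j' \<longleftrightarrow>
    l = l' \<and> r = r' \<and> c = c' \<and> i = i' \<and> j = j'"
  using assms by (simp only: output_cell_def add_left_cancel mult_add_less_inject) blast

lemma input_cell_less_output_cell:
  assumes "b < m" "i' < n" "j' < n"
  shows "input_cell n b i' j' < output_cell n m l r c i j"
proof -
  have "input_cell n b i' j' < Suc b * (n * n)"
    using mult_add_less_square[OF assms(2,3)] by (simp add: input_cell_def)
  also have "\<dots> \<le> m * (n * n)" using assms(1) by (intro mult_le_mono1) simp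
  finally show ?thesis by (simp add: output_cell_def)
qed

lemma output_cell_div_mod:
  "output_cell n m l (i div n) (j div n) (i mod n) (j mod n) =
    m * (n * n) + l * (2 * n * (2 * n)) + i * (2 * n) + j"
proof -
  have "(l * 2 + i div n) * n + i mod n = l * 2 * n + i"
    by (simp only: add_mult_distrib add.assoc div_mult_mod_eq)
  then have "output_cell n m l (i div n) (j div n) (i mod n) (j mod n) =
      m * (n * n) + ((l * 2 * n + i) * 2 * n + (j div n * n + j mod n))"
    by (simp only: output_cell_def add_mult_distrib add.assoc)
  then show ?thesis by (simp add: algebra_simps)
qed

definition stores :: "nat \<Rightarrow> 'a mat list \<Rightarrow> (nat \<Rightarrow> nat \<times> nat \<Rightarrow> 'a mat) \<Rightarrow> 'a state \<Rightarrow> bool" where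
  "stores n Xs Q s \<longleftrightarrow>
     reg s dim_reg = n \<and> reg s base_reg = length Xs * (n * n) \<and>
     reg s square_reg = n * n \<and> reg s one_reg = 1 \<and>
     (\<forall>b < length Xs. \<forall>i < n. \<forall>j < n. mem s (input_cell n b i j) = (Xs ! b) $$ (i, j)) \<and>
     (\<forall>l. \<forall>r < 2. \<forall>c < 2. \<forall>i < n. \<forall>j < n.
        mem s (output_cell n (length Xs) l r c i j) = Q l (r, c) $$ (i, j))"

abbreviation set_quadrant ::
  "(nat \<Rightarrow> nat \<times> nat \<Rightarrow> 'a mat) \<Rightarrow> nat \<Rightarrow> nat \<Rightarrow> nat \<Rightarrow> 'a mat \<Rightarrow> nat \<Rightarrow> nat \<times> nat \<Rightarrow> 'a mat"
where
  "set_quadrant Q l r c M \<equiv> Q(l := (Q l)((r, c) := M))"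

definition assemble :: "(nat \<times> nat \<Rightarrow> 'a mat) \<Rightarrow> 'a mat" where
  "assemble G = four_block_mat (G (0, 0)) (G (0, 1)) (G (1, 0)) (G (1, 1))"

lemma stores_reg_update:
  assumes "stores n Xs Q s" "x \<notin> {dim_reg, base_reg, square_reg, one_reg}"
  shows "stores n Xs Q (s\<lparr>reg := (reg s)(x := v)\<rparr>)"
  using assms by (simp add: stores_def)

lemma stores_cong:
  assumes "stores n Xs Q s"
    and "\<And>l r c i j. r < 2 \<Longrightarrow> c < 2 \<Longrightarrow> i < n \<Longrightarrow> j < n \<Longrightarrow> Q l (r, c) $$ (i, j) = Q' l (r, c) $$ (i, j)"
  shows "stores n Xs Q' s"
  using assms by (simp add: stores_def)

lemma stores_write:
  assumes "stores n Xs Q s" and "r < 2" "c < 2" "i < n" "j < n"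
    and "\<And>i' j'. i' < n \<Longrightarrow> j' < n \<Longrightarrow>
      M $$ (i', j') = (if i' = i \<and> j' = j then v else Q l (r, c) $$ (i', j'))"
  shows "stores n Xs (set_quadrant Q l r c M)
    (s\<lparr>mem := (mem s)(output_cell n (length Xs) l r c i j := v)\<rparr>)"
proof -
  have "input_cell n b i' j' \<noteq> output_cell n (length Xs) l r c i j"
    if "b < length Xs" "i' < n" "j' < n" for b i' j'
    using input_cell_less_output_cell[OF that] by (simp add: less_imp_neq)
  then show ?thesis
    using assms by (auto simp: stores_def output_cell_inject)
qed

lemma assemble_index:
  assumes "\<And>q. G q \<in> carrier_mat n n" "i < 2 * n" "j < 2 * n"
  shows "assemble G $$ (i, j) = G (i div n, j div n) $$ (i mod n, j mod n)"
proof -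
  have dim: "dim_row (G q) = n" "dim_col (G q) = n" for q
    using assms(1)[of q] by auto
  have "m div n = (if m < n then 0 else 1)" "m mod n = (if m < n then m else m - n)"
    if "m < 2 * n" for m
    using that by (auto simp: le_div_geq le_mod_geq)
  then show ?thesis
    using assms(2,3) by (simp add: assemble_def dim)
qed

lemma represents_assemble:
  assumes stores: "stores n Xs Q s" and carrier: "\<And>l q. l < k \<Longrightarrow> Q l q \<in> carrier_mat n n"
  shows "represents (s\<lparr>reg := (reg s)(dim_reg := 2 * n)\<rparr>) (2 * n)
    (map (\<lambda>l. assemble (Q l)) [0..<k])"
proof -
  have "mem s (length Xs * (n * n) + l * (2 * n * (2 * n)) + i * (2 * n) + j) =
      assemble (Q l) $$ (i, j)" if l: "l < k" and ij: "i < 2 * n" "j < 2 * n" for l i j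
  proof -
    have "i div n < 2" "j div n < 2" and "0 < n"
      using ij by (auto simp: less_mult_imp_div_less)
    then have "mem s (output_cell n (length Xs) l (i div n) (j div n) (i mod n) (j mod n)) =
        Q l (i div n, j div n) $$ (i mod n, j mod n)"
      using stores by (simp add: stores_def)
    then show ?thesis
      unfolding output_cell_div_mod using assemble_index[OF carrier[OF l] ij] by simp
  qed
  then show ?thesis
    using stores by (simp add: represents_def stores_def)
qed

section \<open>Updating one quadrant\<close>

definition entrywise :: "nat \<Rightarrow> (nat \<Rightarrow> nat \<Rightarrow> 'a \<Rightarrow> 'a \<Rightarrow> 'a) \<Rightarrow> 'a mat \<Rightarrow> 'a mat \<Rightarrow> 'a mat" where
  "entrywise n g D X = mat n n (\<lambda>(i, j). g i j (D $$ (i, j)) (X $$ (i, j)))"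

definition entrywise_upto ::
  "nat \<Rightarrow> nat \<Rightarrow> (nat \<Rightarrow> nat \<Rightarrow> 'a \<Rightarrow> 'a \<Rightarrow> 'a) \<Rightarrow> 'a mat \<Rightarrow> 'a mat \<Rightarrow> 'a mat" where
  "entrywise_upto n t g D X = mat n n (\<lambda>(i, j).
     if i * n + j < t then g i j (D $$ (i, j)) (X $$ (i, j)) else D $$ (i, j))"

definition updates_entry ::
  "prog \<Rightarrow> (nat \<Rightarrow> nat \<Rightarrow> 'a::{ring,monoid_mult} \<Rightarrow> 'a \<Rightarrow> 'a) \<Rightarrow> bool" where
  "updates_entry p g \<longleftrightarrow> (\<forall>s. \<exists>t \<le> 2. run p s t (s\<lparr>mem := (mem s)(reg s dst_reg :=
     g (reg s row_reg) (reg s col_reg) (mem s (reg s dst_reg)) (mem s (reg s src_reg)))\<rparr>))"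

definition next_entry :: "instr list" where
  "next_entry = [IAdd src_reg src_reg one_reg, IAdd dst_reg dst_reg one_reg]"

definition for_entries :: "prog \<Rightarrow> prog" where
  "for_entries p = for_dim row_reg
     (seq [for_dim col_reg (seq [p, instrs next_entry]), Do (IAdd dst_reg dst_reg dim_reg)])"

definition locate_quadrant :: "nat \<Rightarrow> nat \<Rightarrow> nat \<Rightarrow> nat \<Rightarrow> instr list" where
  "locate_quadrant b l r c =
     IConst src_reg 0 # replicate b (IAdd src_reg src_reg square_reg) @
     ICopy dst_reg base_reg # replicate (4 * l + 2 * r) (IAdd dst_reg dst_reg square_reg) @
     replicate c (IAdd dst_reg dst_reg dim_reg)"

definition update_quadrant :: "prog \<Rightarrow> nat \<Rightarrow> nat \<Rightarrow> nat \<Rightarrow> nat \<Rightarrow> prog" where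
  "update_quadrant p b l r c = seq [instrs (locate_quadrant b l r c), for_entries p]"

locale quadrant_update =
  fixes p :: prog
    and g :: "nat \<Rightarrow> nat \<Rightarrow> 'a::{ring,monoid_mult} \<Rightarrow> 'a \<Rightarrow> 'a"
    and n :: nat
    and Xs :: "'a mat list"
    and Q :: "nat \<Rightarrow> nat \<times> nat \<Rightarrow> 'a mat"
    and b l r c :: nat
  assumes p: "updates_entry p g"
    and b: "b < length Xs"
    and r: "r < 2"
    and c: "c < 2"
begin

definition updated_upto :: "nat \<Rightarrow> nat \<Rightarrow> nat \<times> nat \<Rightarrow> 'a mat" where
  "updated_upto t = set_quadrant Q l r c (entrywise_upto n t g (Q l (r, c)) (Xs ! b))"

definition at_entry :: "nat \<Rightarrow> nat \<Rightarrow> nat \<Rightarrow> 'a state \<Rightarrow> bool" where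
  "at_entry t i j s \<longleftrightarrow> stores n Xs (updated_upto t) s \<and>
     reg s src_reg = input_cell n b i j \<and> reg s dst_reg = output_cell n (length Xs) l r c i j"

lemma at_entry_regs: "at_entry t i j s \<Longrightarrow> reg s dim_reg = n \<and> reg s one_reg = 1"
  by (simp add: at_entry_def stores_def)

lemma at_entry_counter_update:
  assumes "at_entry t i j s" "x \<in> {row_reg, col_reg}"
  shows "at_entry t i j (s\<lparr>reg := (reg s)(x := v)\<rparr>)"
  using assms by (auto simp: at_entry_def intro: stores_reg_update)

lemma stores_updated_upto_Suc:
  assumes "stores n Xs (updated_upto (i * n + j)) s" and ij: "i < n" "j < n"
  shows "stores n Xs (updated_upto (Suc (i * n + j)))
    (s\<lparr>mem := (mem s)(output_cell n (length Xs) l r c i j :=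
      g i j (Q l (r, c) $$ (i, j)) ((Xs ! b) $$ (i, j)))\<rparr>)"
proof -
  let ?Q = "updated_upto (i * n + j)"
  have "stores n Xs (set_quadrant ?Q l r c
      (entrywise_upto n (Suc (i * n + j)) g (Q l (r, c)) (Xs ! b)))
    (s\<lparr>mem := (mem s)(output_cell n (length Xs) l r c i j :=
      g i j (Q l (r, c) $$ (i, j)) ((Xs ! b) $$ (i, j)))\<rparr>)"
    using assms(1) r c ij
    by (rule stores_write)
      (auto simp: updated_upto_def entrywise_upto_def less_Suc_eq mult_add_less_inject[OF _ ij(2)])
  then show ?thesis by (simp add: updated_upto_def)
qed

lemma triple_entry:
  assumes ij: "i < n" "j < n"
  shows "triple (\<lambda>s. at_entry (i * n + j) i j s \<and> reg s row_reg = i \<and> reg s col_reg = j) p 2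
    (\<lambda>s. at_entry (Suc (i * n + j)) i j s \<and> reg s row_reg = i \<and> reg s col_reg = j)"
  unfolding triple_def
proof (intro allI impI)
  fix s assume s: "at_entry (i * n + j) i j s \<and> reg s row_reg = i \<and> reg s col_reg = j"
  let ?s = "s\<lparr>mem := (mem s)(output_cell n (length Xs) l r c i j :=
    g i j (Q l (r, c) $$ (i, j)) ((Xs ! b) $$ (i, j)))\<rparr>"
  have "mem s (reg s src_reg) = (Xs ! b) $$ (i, j)" "mem s (reg s dst_reg) = Q l (r, c) $$ (i, j)"
    using s b r c ij by (auto simp: at_entry_def stores_def updated_upto_def entrywise_upto_def)
  then obtain t where run: "t \<le> 2" "run p s t ?s"
    using p s unfolding updates_entry_def at_entry_def by metis
  have "stores n Xs (updated_upto (Suc (i * n + j))) ?s"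
    using s ij by (intro stores_updated_upto_Suc) (simp_all add: at_entry_def)
  then have "at_entry (Suc (i * n + j)) i j ?s \<and> reg ?s row_reg = i \<and> reg ?s col_reg = j"
    using s by (simp add: at_entry_def)
  then show "\<exists>t s'. run p s t s' \<and> t \<le> 2 \<and>
      at_entry (Suc (i * n + j)) i j s' \<and> reg s' row_reg = i \<and> reg s' col_reg = j"
    using run by blast
qed

lemma triple_next_entry:
  "triple (\<lambda>s. at_entry t i j s \<and> reg s row_reg = i \<and> reg s col_reg = j) (instrs next_entry) 2
    (\<lambda>s. at_entry t i (Suc j) s \<and> reg s row_reg = i \<and> reg s col_reg = j)"
  by (rule triple_instrs)
    (auto simp: next_entry_def at_entry_def stores_def input_cell_def output_cell_def)

lemma triple_row:
  assumes i: "i < n"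
  shows "triple (\<lambda>s. at_entry (i * n) i 0 s \<and> reg s row_reg = i)
    (for_dim col_reg (seq [p, instrs next_entry])) (n * (4 + 2) + 2)
    (\<lambda>s. at_entry (i * n + n) i n s \<and> reg s row_reg = i)"
proof -
  let ?I = "\<lambda>j s. at_entry (i * n + j) i j s \<and> reg s row_reg = i"
  have "triple (?I 0) (for_dim col_reg (seq [p, instrs next_entry])) (n * (4 + 2) + 2) (?I n)"
  proof (rule triple_for_dim)
    fix j assume "j < n"
    show "triple (\<lambda>s. ?I j s \<and> reg s col_reg = j) (seq [p, instrs next_entry]) 4
        (\<lambda>s. ?I (Suc j) s \<and> reg s col_reg = j)"
      by (rule triple_conseq[OF triple_seq_Cons[OF triple_entry[OF i \<open>j < n\<close>]
          triple_seq_Cons[OF triple_next_entry triple_seq_Nil]]]) auto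
  qed (auto simp: at_entry_counter_update dest: at_entry_regs)
  then show ?thesis by simp
qed

lemma triple_for_entries:
  "triple (at_entry 0 0 0) (for_entries p) (6 * n * n + 5 * n + 2) (at_entry (n * n) n 0)"
proof -
  let ?row = "for_dim col_reg (seq [p, instrs next_entry])"
  have next_row: "triple (\<lambda>s. at_entry (i * n + n) i n s \<and> reg s row_reg = i)
      (Do (IAdd dst_reg dst_reg dim_reg)) 1
      (\<lambda>s. at_entry (Suc i * n) (Suc i) 0 s \<and> reg s row_reg = i)" for i
    by (rule triple_Do)
      (auto simp: at_entry_def stores_def input_cell_def output_cell_def algebra_simps)
  have "triple (at_entry (0 * n) 0 0) (for_entries p)
      (n * ((n * (4 + 2) + 2 + (1 + 0)) + 2) + 2) (at_entry (n * n) n 0)"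
    unfolding for_entries_def
  proof (rule triple_for_dim)
    fix i assume "i < n"
    show "triple (\<lambda>s. at_entry (i * n) i 0 s \<and> reg s row_reg = i)
        (seq [?row, Do (IAdd dst_reg dst_reg dim_reg)]) (n * (4 + 2) + 2 + (1 + 0))
        (\<lambda>s. at_entry (Suc i * n) (Suc i) 0 s \<and> reg s row_reg = i)"
      by (rule triple_seq_Cons[OF triple_row[OF \<open>i < n\<close>]
          triple_seq_Cons[OF next_row triple_seq_Nil]])
  qed (auto simp: at_entry_counter_update dest: at_entry_regs)
  then show ?thesis by (rule triple_conseq) (auto simp: algebra_simps)
qed

lemma triple_locate_quadrant:
  "triple (stores n Xs Q) (instrs (locate_quadrant b l r c)) (b + 4 * l + 2 * r + c + 2)
    (at_entry 0 0 0)"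
proof (rule triple_instrs)
  fix s assume s: "stores n Xs Q s"
  have "stores n Xs (updated_upto 0) s"
    using s by (rule stores_cong) (simp add: updated_upto_def entrywise_upto_def)
  then show "at_entry 0 0 0 (fold exec (locate_quadrant b l r c) s)"
    by (simp add: locate_quadrant_def exec_IAdd_funpow at_entry_def stores_def
        input_cell_def output_cell_def algebra_simps)
qed (simp add: locate_quadrant_def)

lemma triple_update_quadrant:
  "triple (stores n Xs Q) (update_quadrant p b l r c)
    (6 * n * n + 5 * n + b + 4 * l + 2 * r + c + 4)
    (stores n Xs (set_quadrant Q l r c (entrywise n g (Q l (r, c)) (Xs ! b))))"
proof -
  have final: "stores n Xs (set_quadrant Q l r c (entrywise n g (Q l (r, c)) (Xs ! b))) s"
    if "at_entry (n * n) n 0 s" for s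
  proof (rule stores_cong)
    show "stores n Xs (updated_upto (n * n)) s"
      using that by (simp add: at_entry_def)
  qed (auto simp: updated_upto_def entrywise_def entrywise_upto_def mult_add_less_square)
  show ?thesis unfolding update_quadrant_def
    by (rule triple_conseq[OF triple_seq_Cons[OF triple_locate_quadrant
        triple_seq_Cons[OF triple_for_entries triple_seq_Nil]] _ _ final]) auto
qed

end

lemma updates_entry_Do:
  assumes "\<And>s. exec i s = s\<lparr>mem := (mem s)(reg s dst_reg :=
    g (reg s row_reg) (reg s col_reg) (mem s (reg s dst_reg)) (mem s (reg s src_reg)))\<rparr>"
  shows "updates_entry (Do i) g"
  unfolding updates_entry_def using run_Do[of i] assms by (metis one_le_numeral)

definition add_entry :: prog where
  "add_entry = Do (RAdd dst_reg dst_reg src_reg)"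

definition subtract_entry :: prog where
  "subtract_entry = Do (RSub dst_reg dst_reg src_reg)"

definition set_diagonal_entry :: prog where
  "set_diagonal_entry = Cond (CEq row_reg col_reg) (Do (ROne dst_reg)) Skip"

lemma updates_entry_add: "updates_entry add_entry (\<lambda>_ _ x y. x + y)"
  unfolding add_entry_def by (rule updates_entry_Do) simp

lemma updates_entry_subtract: "updates_entry subtract_entry (\<lambda>_ _ x y. x - y)"
  unfolding subtract_entry_def by (rule updates_entry_Do) simp

lemma updates_entry_set_diagonal:
  "updates_entry set_diagonal_entry (\<lambda>i j x _. if i = j then 1 else x)"
  unfolding updates_entry_def set_diagonal_entry_def
proof
  fix s :: "'a state"
  let ?p = "Cond (CEq row_reg col_reg) (Do (ROne dst_reg)) Skip"
  show "\<exists>t \<le> 2. run ?p s t (s\<lparr>mem := (mem s)(reg s dst_reg :=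
    if reg s row_reg = reg s col_reg then 1 else mem s (reg s dst_reg))\<rparr>)"
  proof (cases "reg s row_reg = reg s col_reg")
    case True
    then have "run ?p s (1 + 1) (exec (ROne dst_reg) s)"
      by (intro run_Cond_True run_Do) simp
    with True show ?thesis by (intro exI[of _ "1 + 1"]) simp
  next
    case False
    then have "run ?p s (1 + 0) s"
      by (intro run_Cond_False run_Skip) simp
    with False show ?thesis by (intro exI[of _ "1 + 0"]) simp
  qed
qed

lemma triple_add_quadrant:
  assumes "b < length Xs" "r < 2" "c < 2" and X: "Xs ! b \<in> carrier_mat n n"
  shows "triple (stores n Xs Q) (update_quadrant add_entry b l r c)
    (6 * n * n + 5 * n + b + 4 * l + 2 * r + c + 4)
    (stores n Xs (set_quadrant Q l r c (Q l (r, c) + Xs ! b)))"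
proof -
  interpret quadrant_update add_entry "\<lambda>_ _ x y. x + y" n Xs Q b l r c
    using assms updates_entry_add by unfold_locales
  have "entrywise n (\<lambda>_ _ x y. x + y) (Q l (r, c)) (Xs ! b) = Q l (r, c) + Xs ! b"
    using X by (auto simp: entrywise_def)
  then show ?thesis using triple_update_quadrant by simp
qed

lemma triple_subtract_quadrant:
  assumes "b < length Xs" "r < 2" "c < 2" and X: "Xs ! b \<in> carrier_mat n n"
  shows "triple (stores n Xs Q) (update_quadrant subtract_entry b l r c)
    (6 * n * n + 5 * n + b + 4 * l + 2 * r + c + 4)
    (stores n Xs (set_quadrant Q l r c (Q l (r, c) - Xs ! b)))"
proof -
  interpret quadrant_update subtract_entry "\<lambda>_ _ x y. x - y" n Xs Q b l r c
    using assms updates_entry_subtract by unfold_locales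
  have "entrywise n (\<lambda>_ _ x y. x - y) (Q l (r, c)) (Xs ! b) = Q l (r, c) - Xs ! b"
    using X by (auto simp: entrywise_def)
  then show ?thesis using triple_update_quadrant by simp
qed

lemma triple_set_identity_quadrant:
  assumes "b < length Xs" "r < 2" "c < 2" and zero: "Q l (r, c) = 0\<^sub>m n n"
  shows "triple (stores n Xs Q) (update_quadrant set_diagonal_entry b l r c)
    (6 * n * n + 5 * n + b + 4 * l + 2 * r + c + 4)
    (stores n Xs (set_quadrant Q l r c (1\<^sub>m n)))"
proof -
  interpret quadrant_update set_diagonal_entry "\<lambda>i j x _. if i = j then 1 else x" n Xs Q b l r c
    using assms updates_entry_set_diagonal by unfold_locales
  have "entrywise n (\<lambda>i j x _. if i = j then 1 else x) (Q l (r, c)) (Xs ! b) = 1\<^sub>m n"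
    unfolding zero by (auto simp: entrywise_def)
  then show ?thesis using triple_update_quadrant by simp
qed

section \<open>The reduction program\<close>

definition initialize :: "nat \<Rightarrow> prog" where
  "initialize m = seq
     [Do (IConst one_reg 1),
      for_dim row_reg (Do (IAdd square_reg square_reg dim_reg)),
      instrs (replicate m (IAdd base_reg base_reg square_reg))]"

lemma triple_initialize:
  fixes Xs :: "'a::{ring,monoid_mult} mat list"
  shows "triple (\<lambda>s. s = initial_state n Xs) (initialize (length Xs)) (3 * n + length Xs + 3)
    (stores n Xs (\<lambda>_ _. 0\<^sub>m n n))"
proof -
  define I where "I i s \<longleftrightarrow> reg s dim_reg = n \<and> reg s base_reg = 0 \<and> reg s square_reg = i * n \<and>
    reg s one_reg = 1 \<and> mem s = mem (initial_state n Xs)" for i and s :: "'a state"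
  have one: "triple (\<lambda>s. s = initial_state n Xs) (Do (IConst one_reg 1)) 1 (I 0)"
    by (rule triple_Do) (simp add: I_def initial_state_def)
  have "triple (\<lambda>s. I i s \<and> reg s row_reg = i) (Do (IAdd square_reg square_reg dim_reg)) 1
      (\<lambda>s. I (Suc i) s \<and> reg s row_reg = i)" for i
    by (rule triple_Do) (simp add: I_def)
  then have square: "triple (I 0) (for_dim row_reg (Do (IAdd square_reg square_reg dim_reg)))
      (n * (1 + 2) + 2) (I n)"
    by (intro triple_for_dim) (auto simp: I_def)
  have input_entries: "mem (initial_state n Xs) (input_cell n b i j) = (Xs ! b) $$ (i, j)"
    if "b < length Xs" "i < n" "j < n" for b i j
    using represents_initial_state[of n Xs] that
    by (simp add: represents_def initial_state_def input_cell_def)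
  have output_entries: "mem (initial_state n Xs) (output_cell n (length Xs) l r c i j) = 0"
    for l r c i j
    by (simp add: initial_state_def output_cell_def)
  have base: "triple (I n) (instrs (replicate (length Xs) (IAdd base_reg base_reg square_reg)))
      (length Xs) (stores n Xs (\<lambda>_ _. 0\<^sub>m n n))"
    by (rule triple_instrs)
      (use input_entries output_entries in \<open>auto simp: exec_IAdd_funpow I_def stores_def\<close>)
  show ?thesis unfolding initialize_def
    by (rule triple_conseq[OF triple_seq_Cons[OF one triple_seq_Cons[OF square
        triple_seq_Cons[OF base triple_seq_Nil]]]]) auto
qed

text \<open>
  The block column of the \<open>l\<close>-th factor that contains \<open>-C\<close> or the identity: multiplication by
  \<open>stacked_identity\<close> moves it to the left in the last factor.
\<close>

definition link_col :: "nat \<Rightarrow> nat \<Rightarrow> nat" where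
  "link_col k l = (if Suc l = k then 0 else 1)"

definition factor_quadrants ::
  "nat \<Rightarrow> 'a::{ring,monoid_mult} mat list \<Rightarrow> 'a mat \<Rightarrow> nat \<Rightarrow> nat \<times> nat \<Rightarrow> 'a mat" where
  "factor_quadrants n As C l =
     (let G = (\<lambda>_. 0\<^sub>m n n)((0, 0) := As ! l); c = link_col (length As) l
      in if l = 0 then G((0, c) := G (0, c) - C) else G((1, c) := 1\<^sub>m n))"

lemma factor_quadrants_carrier:
  assumes "set As \<subseteq> carrier_mat n n" "C \<in> carrier_mat n n" "l < length As"
  shows "factor_quadrants n As C l q \<in> carrier_mat n n"
proof -
  have "As ! l \<in> carrier_mat n n" using assms by auto
  then show ?thesis using assms by (auto simp: factor_quadrants_def Let_def minus_carrier_mat)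
qed

lemma assemble_factor_quadrants:
  assumes "set As \<subseteq> carrier_mat n n" and C: "C \<in> carrier_mat n n" and "l < length As"
  shows "assemble (factor_quadrants n As C l) = factor n As C l"
proof -
  have A: "As ! l \<in> carrier_mat n n" using assms by auto
  have "0\<^sub>m n n - C = - C" using C by auto
  then have assemble: "assemble (factor_quadrants n As C l) =
      (if Suc l = length As
       then if l = 0 then four_block_mat (As ! l - C) (0\<^sub>m n n) (0\<^sub>m n n) (0\<^sub>m n n)
         else four_block_mat (As ! l) (0\<^sub>m n n) (1\<^sub>m n) (0\<^sub>m n n)
       else base_factor n As C l)"
    by (simp add: assemble_def factor_quadrants_def link_col_def
        base_factor_def augment_def border_def)
  show ?thesis
    unfolding assemble factor_def base_factor_def using A C
    by (cases "l = 0") (simp_all add: augment_mult_stacked_identity border_mult_stacked_identity)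
qed

definition write_link :: "nat \<Rightarrow> nat \<Rightarrow> prog" where
  "write_link k l =
     (if l = 0 then update_quadrant subtract_entry k 0 0 (link_col k 0)
      else update_quadrant set_diagonal_entry 0 l 1 (link_col k l))"

definition write_factor :: "nat \<Rightarrow> nat \<Rightarrow> prog" where
  "write_factor k l = seq [update_quadrant add_entry l l 0 0, write_link k l]"

definition reduction :: "nat \<Rightarrow> prog" where
  "reduction k = seq
     [initialize (Suc k), seq (map (write_factor k) [0..<k]), Do (IAdd dim_reg dim_reg dim_reg)]"

definition write_time :: "nat \<Rightarrow> nat \<Rightarrow> nat" where
  "write_time k n = 6 * n * n + 5 * n + 5 * k + 7"

definition reduction_time :: "nat \<Rightarrow> nat \<Rightarrow> nat" where
  "reduction_time k n = 3 * n + k + 5 + k * (2 * write_time k n)"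

lemma triple_write_link:
  fixes As :: "'a::{ring,monoid_mult} mat list"
  assumes C: "C \<in> carrier_mat n n" and l: "l < length As"
    and Q: "Q l = (\<lambda>_. 0\<^sub>m n n)((0, 0) := As ! l)"
  shows "triple (stores n (As @ [C]) Q) (write_link (length As) l) (write_time (length As) n)
    (stores n (As @ [C]) (Q(l := factor_quadrants n As C l)))"
proof (cases "l = 0")
  case True
  then show ?thesis
    using triple_subtract_quadrant[of "length As" "As @ [C]" 0 "link_col (length As) 0" n Q 0] C Q
    by (auto simp: write_link_def write_time_def factor_quadrants_def link_col_def Let_def
        elim!: triple_conseq)
next
  case False
  then show ?thesis
    using triple_set_identity_quadrant[of 0 "As @ [C]" 1 "link_col (length As) l" Q l n] l Q
    by (auto simp: write_link_def write_time_def factor_quadrants_def link_col_def Let_def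
        elim!: triple_conseq)
qed

lemma triple_write_factor:
  fixes As :: "'a::{ring,monoid_mult} mat list"
  assumes As: "set As \<subseteq> carrier_mat n n" and C: "C \<in> carrier_mat n n" and l: "l < length As"
    and Q: "Q l = (\<lambda>_. 0\<^sub>m n n)"
  shows "triple (stores n (As @ [C]) Q) (write_factor (length As) l) (2 * write_time (length As) n)
    (stores n (As @ [C]) (Q(l := factor_quadrants n As C l)))"
proof -
  let ?Q = "Q(l := (\<lambda>_. 0\<^sub>m n n)((0, 0) := As ! l))"
  have "As ! l \<in> carrier_mat n n" using As l by auto
  then have "triple (stores n (As @ [C]) Q) (update_quadrant add_entry l l 0 0)
      (6 * n * n + 5 * n + l + 4 * l + 2 * 0 + 0 + 4) (stores n (As @ [C]) ?Q)"
    using triple_add_quadrant[of l "As @ [C]" 0 0 n Q l] l by (simp add: Q nth_append)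
  then have main: "triple (stores n (As @ [C]) Q) (update_quadrant add_entry l l 0 0)
      (write_time (length As) n) (stores n (As @ [C]) ?Q)"
    by (rule triple_conseq) (use l in \<open>auto simp: write_time_def\<close>)
  have link: "triple (stores n (As @ [C]) ?Q) (write_link (length As) l)
      (write_time (length As) n) (stores n (As @ [C]) (Q(l := factor_quadrants n As C l)))"
    using triple_write_link[OF C l, of ?Q] by simp
  show ?thesis unfolding write_factor_def
    by (rule triple_conseq[OF triple_seq_Cons[OF main triple_seq_Cons[OF link triple_seq_Nil]]]) auto
qed

lemma triple_reduction:
  fixes As :: "'a::{ring,monoid_mult} mat list"
  assumes As: "set As \<subseteq> carrier_mat n n" and C: "C \<in> carrier_mat n n"
  shows "triple (\<lambda>s. s = initial_state n (As @ [C])) (reduction (length As))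
    (reduction_time (length As) n)
    (\<lambda>s. represents s (2 * n) (map (factor n As C) [0..<length As]))"
proof -
  let ?k = "length As" and ?Xs = "As @ [C]"
  let ?Q = "\<lambda>m l. if l < m then factor_quadrants n As C l else (\<lambda>_. 0\<^sub>m n n)"
  have init: "triple (\<lambda>s. s = initial_state n ?Xs) (initialize (Suc ?k)) (3 * n + Suc ?k + 3)
      (stores n ?Xs (?Q 0))"
    using triple_initialize[of n ?Xs] by simp
  have "triple (stores n ?Xs (?Q l)) (write_factor ?k l) (2 * write_time ?k n)
      (stores n ?Xs (?Q (Suc l)))"
    if "l < ?k" for l
  proof -
    have "(?Q l)(l := factor_quadrants n As C l) = ?Q (Suc l)" by (auto simp: less_Suc_eq)
    then show ?thesis using triple_write_factor[OF As C that, of "?Q l"] by simp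
  qed
  then have factors: "triple (stores n ?Xs (?Q 0)) (seq (map (write_factor ?k) [0..<?k]))
      (?k * (2 * write_time ?k n)) (stores n ?Xs (?Q ?k))"
    by (rule triple_seq_upt)
  have carrier: "?Q ?k l q \<in> carrier_mat n n" if "l < ?k" for l q
    using factor_quadrants_carrier[OF As C that] that by simp
  have assembled: "map (\<lambda>l. assemble (?Q ?k l)) [0..<?k] = map (factor n As C) [0..<?k]"
    using assemble_factor_quadrants[OF As C] by simp
  have "represents (exec (IAdd dim_reg dim_reg dim_reg) s) (2 * n) (map (factor n As C) [0..<?k])"
    if "stores n ?Xs (?Q ?k) s" for s
    using represents_assemble[OF that, of ?k, OF carrier] that unfolding assembled
    by (simp add: stores_def mult_2)
  then have finish: "triple (stores n ?Xs (?Q ?k)) (Do (IAdd dim_reg dim_reg dim_reg)) 1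
      (\<lambda>s. represents s (2 * n) (map (factor n As C) [0..<?k]))"
    by (rule triple_Do)
  show ?thesis unfolding reduction_def
    by (rule triple_conseq[OF triple_seq_Cons[OF init triple_seq_Cons[OF factors
        triple_seq_Cons[OF finish triple_seq_Nil]]]]) (auto simp: reduction_time_def)
qed

lemma is_reduction_MMV_AllZeroes:
  assumes "0 < k"
  shows "is_reduction (reduction k) (MMV k :: 'a::{ring,monoid_mult} problem) (AllZeroes k)
    (\<lambda>n. 2 * n) (reduction_time k)"
  unfolding is_reduction_def
proof (intro allI ballI)
  fix n and x :: "'a mat list" assume "x \<in> instances (MMV k) n"
  then obtain As C where x: "x = As @ [C]" and k: "length As = k"
    and As: "set As \<subseteq> carrier_mat n n" and C: "C \<in> carrier_mat n n"
    by (auto simp: MMV_def)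
  let ?y = "map (factor n As C) [0..<k]"
  have y: "?y \<in> instances (AllZeroes k) (2 * n)"
    using factor_carrier[OF As] k by (auto simp: AllZeroes_def mult_2)
  obtain t s where "run (reduction k) (initial_state n x) t s" "t \<le> reduction_time k n"
      "represents s (2 * n) ?y"
    using triple_reduction[OF As C] unfolding triple_def x k by blast
  moreover have "x \<in> yes_instances (MMV k) n \<longleftrightarrow> mat_prod_list n As = C"
    using As C k by (auto simp: MMV_def x)
  moreover have "?y \<in> yes_instances (AllZeroes k) (2 * n) \<longleftrightarrow> mat_prod_list n As = C"
    using mat_prod_list_factors_eq_zero_iff[of As n C] As C k y assms
    by (auto simp: AllZeroes_def mult_2)
  ultimately show "\<exists>t s. \<exists>y \<in> instances (AllZeroes k) (2 * n).
      run (reduction k) (initial_state n x) t s \<and> t \<le> reduction_time k n \<and>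
      represents s (2 * n) y \<and>
      (x \<in> yes_instances (MMV k) n \<longleftrightarrow> y \<in> yes_instances (AllZeroes k) (2 * n))"
    using y by blast
qed

lemma quadratic_in_bigo:
  "(\<lambda>n. a * real n ^ 2 + b * real n + c) \<in> O(\<lambda>n. real n ^ 2)"
proof -
  have "real n \<le> real n ^ 2" for n
    by (simp add: power2_eq_square flip: of_nat_mult)
  then have "(\<lambda>n. b * real n) \<in> O(\<lambda>n. real n ^ 2)"
    by (intro bigoI[of _ "\<bar>b\<bar>"] always_eventually) (auto simp: abs_mult intro: mult_left_mono)
  moreover have "(\<lambda>n. c) \<in> O(\<lambda>n. real n ^ 2)"
    by (intro bigoI[of _ "\<bar>c\<bar>"] eventually_sequentiallyI[of 1]) (auto simp: mult_le_cancel_left1)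
  ultimately show ?thesis by (intro sum_in_bigo) auto
qed

lemma reduction_time_in_bigo: "(\<lambda>n. real (reduction_time k n)) \<in> O(\<lambda>n. real n ^ 2)"
  using quadratic_in_bigo[of "12 * real k" "10 * real k + 3" "real (k + 5 + k * (10 * k + 14))"]
  by (simp add: reduction_time_def write_time_def algebra_simps power2_eq_square)

theorem theorem5p10:
  fixes k :: nat
  assumes "k > 0"
  shows "\<exists>p T. (\<lambda>n. real (T n)) \<in> O(\<lambda>n. real n ^ 2) \<and>
    is_reduction p (MMV k :: 'a::{ring,monoid_mult} problem) (AllZeroes k) (\<lambda>n. 2 * n) T"
  using reduction_time_in_bigo is_reduction_MMV_AllZeroes[OF assms] by blast

end
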